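(* Let $X$ be a topological space which is a $k$-space. Then $X$ contains no $\mathrm{Cld}$-fans and no $\mathrm{Fin}$-fans; that is, for every cardinal $\lambda$, no indexed family $(F_\alpha)_{\alpha\in\lambda}$ consisting of closed subsets of $X$, and no indexed family $(F_\alpha)_{\alpha\in\lambda}$ consisting of finite subsets of $X$, is a fan in $X$.
   Context: A topological space $X$ is a $k$-space if every $k$-closed subset of $X$ is closed, where $A\subset X$ is $k$-closed if $A\cap K$ is closed in $K$ for every compact subset $K\subset X$. Let $\lambda$ be a cardinal. A family $(F_\alpha)_{\alpha\in\lambda}$ of subsets of $X$ is locally finite if each $x\in X$ has a neighborhood $O_x$ such that $\{\alpha\in\lambda: O_x\cap F_\alpha\neq\emptyset\}$ is finite; it is compact-finite if for each compact $K\subset X$ the set $\{\alpha\in\lambda: K\cap F_\alpha\ne\emptyset\}$ is finite. A fan in $X$ is an indexed family $(F_\alpha)_{\alpha\in\lambda}$ ($\lambda$ a cardinal) of subsets of $X$ which is compact-finite but not locally finite. A $\mathrm{Cld}$-fan (resp. $\mathrm{Fin}$-fan) is a fan all of whose members are closed (resp. finite) subsets of $X$. *)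

theory Defs
  imports "HOL-Analysis.Analysis"
begin

(* Families are indexed, so a set occurring for infinitely many indices counts infinitely
   often; the library's locally_finite_in concerns sets of sets and does not see this. *)

definition locally_finite_family :: "'a topology \<Rightarrow> 'i set \<Rightarrow> ('i \<Rightarrow> 'a set) \<Rightarrow> bool" where
  "locally_finite_family X I F \<longleftrightarrow>
     (\<forall>x \<in> topspace X. \<exists>U. openin X U \<and> x \<in> U \<and> finite {\<alpha> \<in> I. U \<inter> F \<alpha> \<noteq> {}})"

definition compact_finite_family :: "'a topology \<Rightarrow> 'i set \<Rightarrow> ('i \<Rightarrow> 'a set) \<Rightarrow> bool" where
  "compact_finite_family X I F \<longleftrightarrow>
     (\<forall>K. compactin X K \<longrightarrow> finite {\<alpha> \<in> I. K \<inter> F \<alpha> \<noteq> {}})"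

(* A cardinal is represented as in the HOL library by a relation r with Card_order r;
   its elements (the indices) form Field r. *)

definition fan :: "'a topology \<Rightarrow> 'i rel \<Rightarrow> ('i \<Rightarrow> 'a set) \<Rightarrow> bool" where
  "fan X r F \<longleftrightarrow>
     Card_order r \<and>
     (\<forall>\<alpha> \<in> Field r. F \<alpha> \<subseteq> topspace X) \<and>
     compact_finite_family X (Field r) F \<and>
     \<not> locally_finite_family X (Field r) F"

definition Cld_fan :: "'a topology \<Rightarrow> 'i rel \<Rightarrow> ('i \<Rightarrow> 'a set) \<Rightarrow> bool" where
  "Cld_fan X r F \<longleftrightarrow> fan X r F \<and> (\<forall>\<alpha> \<in> Field r. closedin X (F \<alpha>))"

definition Fin_fan :: "'a topology \<Rightarrow> 'i rel \<Rightarrow> ('i \<Rightarrow> 'a set) \<Rightarrow> bool" where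
  "Fin_fan X r F \<longleftrightarrow> fan X r F \<and> (\<forall>\<alpha> \<in> Field r. finite (F \<alpha>))"

end

theory Submission
  imports Defs
begin

text \<open>
  In a \<open>k\<close>-space the union of a compact-finite family of closed sets is \<open>k\<close>-closed, hence closed.
  Removing the finitely many members through a point \<open>x\<close>, the complement of the union of the others
  is a neighbourhood of \<open>x\<close> witnessing local finiteness. Points need not be closed, so finite
  members are first replaced by their closures. Compact-finiteness survives this: if \<open>x \<in> K\<close> lies
  in the closure of \<open>{y}\<close>, every open set containing \<open>x\<close> contains \<open>y\<close>, so adjoining all such \<open>y\<close> to
  a compact set \<open>K\<close> keeps it compact.
\<close>

text \<open>A compact \<open>K\<close> meets only finitely many members, so inside \<open>K\<close>
  the union agrees with a finite union of closed sets. Hence the union is k-closed.\<close>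

lemma closedin_Union_compact_finite:
  assumes k: "k_space X" and cf: "compact_finite_family X I F"
    and cl: "\<And>\<alpha>. \<alpha> \<in> I \<Longrightarrow> closedin X (F \<alpha>)"
  shows "closedin X (\<Union>\<alpha>\<in>I. F \<alpha>)"
proof -
  have "closedin (subtopology X K) (K \<inter> (\<Union>\<alpha>\<in>I. F \<alpha>))" if K: "compactin X K" for K
  proof -
    let ?J = "{\<alpha> \<in> I. K \<inter> F \<alpha> \<noteq> {}}"
    have "finite ?J"
      using cf K by (simp add: compact_finite_family_def)
    then have "closedin X (\<Union>\<alpha>\<in>?J. F \<alpha>)"
      using cl by (intro closedin_Union) auto
    moreover have "K \<inter> (\<Union>\<alpha>\<in>I. F \<alpha>) = K \<inter> (\<Union>\<alpha>\<in>?J. F \<alpha>)"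
      by auto
    ultimately show ?thesis
      by (simp add: closedin_subtopology_Int_closed)
  qed
  moreover have "(\<Union>\<alpha>\<in>I. F \<alpha>) \<subseteq> topspace X"
    by (intro UN_least closedin_subset cl)
  ultimately show ?thesis
    using k unfolding k_space by blast
qed

lemma compact_finite_family_subset:
  assumes "compact_finite_family X I F" "J \<subseteq> I"
  shows "compact_finite_family X J F"
  unfolding compact_finite_family_def
proof (intro allI impI)
  fix K assume "compactin X K"
  then have "finite {\<alpha> \<in> I. K \<inter> F \<alpha> \<noteq> {}}"
    using assms(1) by (simp add: compact_finite_family_def)
  then show "finite {\<alpha> \<in> J. K \<inter> F \<alpha> \<noteq> {}}"
    by (rule rev_finite_subset) (use assms(2) in blast)
qed

lemma k_space_closed_compact_finite_imp_locally_finite: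
  assumes k: "k_space X" and cf: "compact_finite_family X I F"
    and cl: "\<And>\<alpha>. \<alpha> \<in> I \<Longrightarrow> closedin X (F \<alpha>)"
  shows "locally_finite_family X I F"
  unfolding locally_finite_family_def
proof
  fix x assume x: "x \<in> topspace X"
  \<comment> \<open>Discarding the members through \<open>x\<close> puts \<open>x\<close> itself
    into \<open>?U\<close>.\<close>
  let ?J = "{\<alpha> \<in> I. x \<notin> F \<alpha>}"
  let ?U = "topspace X - (\<Union>\<alpha>\<in>?J. F \<alpha>)"
  have "compact_finite_family X ?J F"
    using cf by (rule compact_finite_family_subset) auto
  then have "closedin X (\<Union>\<alpha>\<in>?J. F \<alpha>)"
    using k cl by (intro closedin_Union_compact_finite) auto
  then have "openin X ?U"
    by blast
  \<comment> \<open>The singleton of \<open>x\<close> is compact, so only finitely many members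
    contain \<open>x\<close>. No others can meet \<open>?U\<close>, which avoids every member
    indexed by \<open>?J\<close>.\<close>
  moreover have "finite {\<alpha> \<in> I. {x} \<inter> F \<alpha> \<noteq> {}}"
    using cf finite_imp_compactin[of "{x}" X] x
    unfolding compact_finite_family_def by blast
  then have "finite {\<alpha> \<in> I. ?U \<inter> F \<alpha> \<noteq> {}}"
    by (rule rev_finite_subset) blast
  ultimately show "\<exists>U. openin X U \<and> x \<in> U \<and> finite {\<alpha> \<in> I. U \<inter> F \<alpha> \<noteq> {}}"
    using x by (intro exI[of _ ?U]) simp
qed

lemma compactin_Un_specializations:
  assumes K: "compactin X K" and B: "B \<subseteq> topspace X"
    and spec: "\<And>y. y \<in> B \<Longrightarrow> \<exists>x\<in>K. x \<in> X closure_of {y}"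
  shows "compactin X (K \<union> B)"
  unfolding compactin_def
proof (intro conjI allI impI)
  show "K \<union> B \<subseteq> topspace X"
    using K B compactin_subset_topspace by blast
next
  fix \<U> assume \<U>: "Ball \<U> (openin X) \<and> K \<union> B \<subseteq> \<Union>\<U>"
  then obtain \<F> where \<F>: "finite \<F>" "\<F> \<subseteq> \<U>" "K \<subseteq> \<Union>\<F>"
    using K unfolding compactin_def by auto
  \<comment> \<open>The finite subcover chosen for \<open>K\<close> alone already covers
    \<open>B\<close>: a member of it containing \<open>x\<close> must meet
    \<open>{y}\<close>.\<close>
  have "y \<in> \<Union>\<F>" if y: "y \<in> B" for y
  proof -
    obtain x where x: "x \<in> K" "x \<in> X closure_of {y}"
      using spec y by blast
    then obtain U where "U \<in> \<F>" "x \<in> U"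
      using \<F> by blast
    moreover have "openin X U"
      using \<U> \<F> \<open>U \<in> \<F>\<close> by blast
    ultimately show ?thesis
      using x(2) by (auto simp: in_closure_of)
  qed
  then show "\<exists>\<F>. finite \<F> \<and> \<F> \<subseteq> \<U> \<and> K \<union> B \<subseteq> \<Union>\<F>"
    using \<F> by blast
qed

text \<open>Closure commutes with finite unions. This lets a point in the closure of a finite member
  be traced to a single point \<open>y\<close> of that member.\<close>

lemma closure_of_finite_eq_Union:
  assumes "finite A"
  shows "X closure_of A = (\<Union>y\<in>A. X closure_of {y})"
  using closure_of_Union[of "(\<lambda>y. {y}) ` A" X] assms by (simp add: UN_singleton)

lemma compact_finite_family_closure_of:
  assumes cf: "compact_finite_family X I F"
    and fin: "\<And>\<alpha>. \<alpha> \<in> I \<Longrightarrow> finite (F \<alpha>)" and sub: "\<And>\<alpha>. \<alpha> \<in> I \<Longrightarrow> F \<alpha> \<subseteq> topspace X"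
  shows "compact_finite_family X I (\<lambda>\<alpha>. X closure_of F \<alpha>)"
  unfolding compact_finite_family_def
proof (intro allI impI)
  fix K assume K: "compactin X K"
  \<comment> \<open>\<open>B\<close> collects all points whose closure meets \<open>K\<close>, so a
    member whose closure meets \<open>K\<close> itself meets the compact set
    \<open>K \<union> B\<close>.\<close>
  define B where "B = {y \<in> topspace X. \<exists>x\<in>K. x \<in> X closure_of {y}}"
  have "compactin X (K \<union> B)"
    using K by (rule compactin_Un_specializations) (auto simp: B_def)
  then have "finite {\<alpha> \<in> I. (K \<union> B) \<inter> F \<alpha> \<noteq> {}}"
    using cf by (simp add: compact_finite_family_def)
  moreover have "(K \<union> B) \<inter> F \<alpha> \<noteq> {}" if \<alpha>: "\<alpha> \<in> I" and meet: "K \<inter> X closure_of F \<alpha> \<noteq> {}" for \<alpha>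
  proof -
    obtain x y where "x \<in> K" "y \<in> F \<alpha>" "x \<in> X closure_of {y}"
      using meet closure_of_finite_eq_Union[OF fin[OF \<alpha>], of X] by auto
    then have "y \<in> B \<inter> F \<alpha>"
      using sub[OF \<alpha>] by (auto simp: B_def)
    then show ?thesis
      by blast
  qed
  ultimately show "finite {\<alpha> \<in> I. K \<inter> X closure_of F \<alpha> \<noteq> {}}"
    by (elim rev_finite_subset) auto
qed

lemma locally_finite_family_mono:
  assumes lf: "locally_finite_family X I G" and sub: "\<And>\<alpha>. \<alpha> \<in> I \<Longrightarrow> F \<alpha> \<subseteq> G \<alpha>"
  shows "locally_finite_family X I F"
  unfolding locally_finite_family_def
proof
  fix x assume "x \<in> topspace X"
  then obtain U where U: "openin X U" "x \<in> U" "finite {\<alpha> \<in> I. U \<inter> G \<alpha> \<noteq> {}}"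
    using lf unfolding locally_finite_family_def by blast
  from U(3) have "finite {\<alpha> \<in> I. U \<inter> F \<alpha> \<noteq> {}}"
    by (rule rev_finite_subset) (use sub in blast)
  with U show "\<exists>U. openin X U \<and> x \<in> U \<and> finite {\<alpha> \<in> I. U \<inter> F \<alpha> \<noteq> {}}"
    by blast
qed

theorem proposition1p3:
  fixes X :: "'a topology" and \<kappa> :: "'i rel"
  assumes "k_space X" and "Card_order \<kappa>"
  shows "(\<nexists>F. Cld_fan X \<kappa> F) \<and> (\<nexists>F. Fin_fan X \<kappa> F)"
proof (intro conjI notI; elim exE)
  fix F assume "Cld_fan X \<kappa> F"
  then show False
    using k_space_closed_compact_finite_imp_locally_finite[OF assms(1)]
    unfolding Cld_fan_def fan_def by blast
next
  fix F assume F: "Fin_fan X \<kappa> F"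
  then have "compact_finite_family X (Field \<kappa>) (\<lambda>\<alpha>. X closure_of F \<alpha>)"
    unfolding Fin_fan_def fan_def by (intro compact_finite_family_closure_of) auto
  then have "locally_finite_family X (Field \<kappa>) (\<lambda>\<alpha>. X closure_of F \<alpha>)"
    by (rule k_space_closed_compact_finite_imp_locally_finite[OF assms(1)]) simp
  \<comment> \<open>Local finiteness passes from the closures down to the original members, each of
    which lies in its closure because it lies in \<open>topspace X\<close>.\<close>
  then have "locally_finite_family X (Field \<kappa>) F"
    by (rule locally_finite_family_mono)
      (use F in \<open>auto simp: Fin_fan_def fan_def intro!: closure_of_subset[THEN subsetD]\<close>)
  with F show False
    unfolding Fin_fan_def fan_def by blast
qed

end
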